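(* Let $\mathcal A$ be a unital $C^*$-algebra. The quasi-state space of $\mathcal A$, defined as the projective limit $$QS(\mathcal A):=\varprojlim S(\mathcal A_\alpha)=\Big\{(\mu_\alpha)\in\prod_\alpha S(\mathcal A_\alpha):\ \mu_\beta|_{\mathcal A_\alpha}=\mu_\alpha\text{ whenever }\mathcal A_\alpha\subseteq\mathcal A_\beta\Big\}$$ over all unital commutative $C^*$-subalgebras $\mathcal A_\alpha$ of $\mathcal A$, is the set of all quasi-states on $\mathcal A$ (via $\mu\mapsto(\mu|_{\mathcal A_\alpha})_\alpha$), equipped with the natural (element-wise) convex structure and with the projective topology: the coarsest topology such that for every unital commutative $C^*$-subalgebra $\mathcal A_\alpha\subseteq\mathcal A$ and every $f\in\mathcal A_\alpha$ the functional $\mu\mapsto\mu_\alpha(f)$ is continuous, where $\mu_\alpha$ is the restriction of $\mu\in QS(\mathcal A)$ to $\mathcal A_\alpha$.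
   Context: Unital commutative $C^*$-subalgebras of $\mathcal A$ contain the unit of $\mathcal A$; $S(\mathcal A_\alpha)$ is the state space of $\mathcal A_\alpha$ with the weak$^*$-topology. The projective limit carries the topology and the (coordinatewise) convex structure induced from the product $\prod_\alpha S(\mathcal A_\alpha)$. A quasi-state on $\mathcal A$ is a map $\mu:\mathcal A\to\mathbb C$ that is linear on all unital commutative $C^*$-subalgebras of $\mathcal A$, satisfies $\mu(a+ib)=\mu(a)+i\mu(b)$ for all self-adjoint $a,b\in\mathcal A$, $\mu(a^*a)\ge0$ for all $a\in\mathcal A$, and $\mu(1)=1$. *)

theory Defs
  imports "HOL-Analysis.Analysis"
begin

text \<open>
  The library only has real normed algebras, so the complex scalar multiplication is added as an
  operation extending \<open>scaleR\<close>. As usual for unital Banach algebras, \<open>norm 1 = 1\<close> (so \<open>0 \<noteq> 1\<close>).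
\<close>

class unital_cstar_algebra = real_normed_algebra_1 + banach +
  fixes scaleC :: "complex \<Rightarrow> 'a \<Rightarrow> 'a" (infixr \<open>*\<^sub>C\<close> 75)
    and star :: "'a \<Rightarrow> 'a"
  assumes scaleC_add_right: "c *\<^sub>C (x + y) = c *\<^sub>C x + c *\<^sub>C y"
    and scaleC_add_left: "(c + d) *\<^sub>C x = c *\<^sub>C x + d *\<^sub>C x"
    and scaleC_scaleC: "c *\<^sub>C (d *\<^sub>C x) = (c * d) *\<^sub>C x"
    and scaleC_of_real: "complex_of_real r *\<^sub>C x = r *\<^sub>R x"
    and mult_scaleC_left: "(c *\<^sub>C x) * y = c *\<^sub>C (x * y)"
    and mult_scaleC_right: "x * (c *\<^sub>C y) = c *\<^sub>C (x * y)"
    and norm_scaleC: "norm (c *\<^sub>C x) = cmod c * norm x"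
    and star_star: "star (star x) = x"
    and star_add: "star (x + y) = star x + star y"
    and star_scaleC: "star (c *\<^sub>C x) = cnj c *\<^sub>C star x"
    and star_mult: "star (x * y) = star y * star x"
    and cstar_identity: "norm (star x * x) = norm x ^ 2"

definition self_adjoint :: "'a::unital_cstar_algebra \<Rightarrow> bool" where
  "self_adjoint a \<longleftrightarrow> star a = a"

definition unital_cstar_subalgebra :: "'a::unital_cstar_algebra set \<Rightarrow> bool" where
  "unital_cstar_subalgebra B \<longleftrightarrow>
     1 \<in> B \<and>
     (\<forall>x\<in>B. \<forall>y\<in>B. x + y \<in> B) \<and>
     (\<forall>c. \<forall>x\<in>B. c *\<^sub>C x \<in> B) \<and>
     (\<forall>x\<in>B. \<forall>y\<in>B. x * y \<in> B) \<and>
     (\<forall>x\<in>B. star x \<in> B) \<and>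
     closed B"

definition comm_subalgebras :: "'a::unital_cstar_algebra set set" where
  "comm_subalgebras = {B. unital_cstar_subalgebra B \<and> (\<forall>x\<in>B. \<forall>y\<in>B. x * y = y * x)}"

definition clinear_on :: "'a::unital_cstar_algebra set \<Rightarrow> ('a \<Rightarrow> complex) \<Rightarrow> bool" where
  "clinear_on B \<phi> \<longleftrightarrow>
     (\<forall>x\<in>B. \<forall>y\<in>B. \<phi> (x + y) = \<phi> x + \<phi> y) \<and> (\<forall>c. \<forall>x\<in>B. \<phi> (c *\<^sub>C x) = c * \<phi> x)"

text \<open>
  A function defined only on \<open>B\<close> is represented by an element of \<open>extensional B\<close>.
\<close>

definition states :: "'a::unital_cstar_algebra set \<Rightarrow> ('a \<Rightarrow> complex) set" where
  "states B =
     {\<phi> \<in> extensional B.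
        clinear_on B \<phi> \<and> (\<forall>a\<in>B. \<phi> (star a * a) \<in> \<real>\<^sub>\<ge>\<^sub>0) \<and> \<phi> 1 = 1}"

text \<open>The weak* topology is the topology of pointwise convergence on \<open>B\<close>.\<close>

definition state_space :: "'a::unital_cstar_algebra set \<Rightarrow> ('a \<Rightarrow> complex) topology" where
  "state_space B = subtopology (product_topology (\<lambda>_. euclidean) B) (states B)"

definition quasi_states :: "('a::unital_cstar_algebra \<Rightarrow> complex) set" where
  "quasi_states =
     {\<mu>. (\<forall>B\<in>comm_subalgebras. clinear_on B \<mu>) \<and>
         (\<forall>a b. self_adjoint a \<and> self_adjoint b \<longrightarrow> \<mu> (a + \<i> *\<^sub>C b) = \<mu> a + \<i> * \<mu> b) \<and>
         (\<forall>a. \<mu> (star a * a) \<in> \<real>\<^sub>\<ge>\<^sub>0) \<and>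
         \<mu> 1 = 1}"

definition QS :: "('a::unital_cstar_algebra set \<Rightarrow> 'a \<Rightarrow> complex) set" where
  "QS = {m \<in> (\<Pi>\<^sub>E B\<in>comm_subalgebras. states B).
           \<forall>A\<in>comm_subalgebras. \<forall>B\<in>comm_subalgebras. A \<subseteq> B \<longrightarrow> restrict (m B) A = m A}"

definition QS_topology :: "('a::unital_cstar_algebra set \<Rightarrow> 'a \<Rightarrow> complex) topology" where
  "QS_topology = subtopology (product_topology state_space comm_subalgebras) QS"

definition QS_combination ::
  "real \<Rightarrow> ('a::unital_cstar_algebra set \<Rightarrow> 'a \<Rightarrow> complex) \<Rightarrow>
   ('a set \<Rightarrow> 'a \<Rightarrow> complex) \<Rightarrow> ('a set \<Rightarrow> 'a \<Rightarrow> complex)" where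
  "QS_combination t m n =
     (\<lambda>B\<in>comm_subalgebras. \<lambda>f\<in>B. (1 - t) *\<^sub>R m B f + t *\<^sub>R n B f)"

definition restrictions ::
  "('a::unital_cstar_algebra \<Rightarrow> complex) \<Rightarrow> ('a set \<Rightarrow> 'a \<Rightarrow> complex)" where
  "restrictions \<mu> = (\<lambda>B\<in>comm_subalgebras. restrict \<mu> B)"

definition coarsest_topology_on :: "'x set \<Rightarrow> ('x topology \<Rightarrow> bool) \<Rightarrow> 'x topology \<Rightarrow> bool" where
  "coarsest_topology_on X P T \<longleftrightarrow>
     topspace T = X \<and> P T \<and>
     (\<forall>T'. topspace T' = X \<and> P T' \<longrightarrow> (\<forall>U. openin T U \<longrightarrow> openin T' U))"

end

theory Submission
  imports Defs
begin

text \<open>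
  A compatible family of states is glued to a functional on self-adjoint elements, each of which lies
  in a commutative subalgebra, and extended by \<open>\<mu> (a + i b) = \<mu> a + i \<mu> b\<close>. The only substantial point
  is \<open>\<mu> (a\<^sup>* a) \<ge> 0\<close> for non-normal \<open>a\<close>: one needs \<open>a\<^sup>* a = r\<^sup>2\<close> with \<open>r\<close> self-adjoint in a commutative
  subalgebra containing \<open>a\<^sup>* a\<close>. This is obtained without spectral theory. The binomial series gives
  square roots of \<open>p\<close> when \<open>\<parallel>1 - p\<parallel> \<le> 1\<close>; it follows that the squares of self-adjoint elements form a
  proper convex cone, and if the negative part of \<open>a\<^sup>* a\<close> were nonzero, one could write a nonzero
  sum of such squares equal to zero.
\<close>

subsection \<open>Square roots by the binomial series\<close>

text \<open>The coefficient of \<open>x ^ n\<close> in the binomial expansion of the square root of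
  \<open>1 - x\<close>.\<close>

abbreviation sqrt_coeff :: "nat \<Rightarrow> real" where
  "sqrt_coeff n \<equiv> (1/2 gchoose n) * (- 1) ^ n"

lemma sqrt_coeff_nonpos: "sqrt_coeff (Suc n) \<le> 0"
proof -
  have "sqrt_coeff (Suc n) = pochhammer (- (1/2)) (Suc n) / fact (Suc n)"
    unfolding gbinomial_pochhammer by (simp flip: power_mult_distrib)
  also have "pochhammer (- (1/2)) (Suc n) = - (1/2) * pochhammer (1/2 :: real) n"
    by (simp add: pochhammer_rec)
  also have "\<dots> / fact (Suc n) \<le> 0"
    by (intro divide_nonpos_pos) (simp_all add: pochhammer_nonneg)
  finally show ?thesis .
qed

text \<open>All these coefficients are nonpositive, so the sum is \<open>1\<close> minus a partial
  sum of \<open>sqrt_coeff\<close>, which has a nonnegative closed form. Hence the series converges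
  even on the boundary of the unit ball.\<close>

lemma sum_abs_sqrt_coeff_le: "(\<Sum>k<n. \<bar>sqrt_coeff (Suc k)\<bar>) \<le> 1"
proof -
  have "(\<Sum>k<n. \<bar>sqrt_coeff (Suc k)\<bar>) = 1 - (\<Sum>k\<le>n. sqrt_coeff k)"
    using sqrt_coeff_nonpos
    by (simp only: sum.atMost_shift abs_of_nonpos) (simp add: sum_negf)
  also have "(\<Sum>k\<le>n. sqrt_coeff k) = (- 1) ^ n * (1/2 - 1 gchoose n)"
    by (rule gbinomial_sum_lower_neg)
  also have "\<dots> = pochhammer (1/2) n / fact n"
    unfolding gbinomial_pochhammer by (simp flip: power_mult_distrib)
  also have "1 - \<dots> \<le> (1::real)"
    by (simp add: pochhammer_nonneg)
  finally show ?thesis .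
qed

lemma summable_abs_sqrt_coeff: "summable (\<lambda>k. \<bar>sqrt_coeff (Suc k)\<bar>)"
  by (rule summableI_nonneg_bounded[where x = 1]) (rule abs_ge_zero, rule sum_abs_sqrt_coeff_le)

text \<open>Vandermonde's identity for \<open>1/2 + 1/2 = 1\<close>: the formal square of the series
  is \<open>1 - x\<close>.\<close>

lemma sqrt_coeff_convolution:
  "(\<Sum>i\<le>k. sqrt_coeff i * sqrt_coeff (k - i)) = (if k = 0 then 1 else if k = 1 then - 1 else 0)"
proof -
  have "(\<Sum>i\<le>k. sqrt_coeff i * sqrt_coeff (k - i)) =
        (- 1) ^ k * (\<Sum>i\<le>k. (1/2 gchoose i) * (1/2 gchoose (k - i)))"
    unfolding sum_distrib_left
  proof (rule sum.cong[OF refl])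
    fix i assume "i \<in> {..k}"
    then have "(- 1 :: real) ^ k = (- 1) ^ i * (- 1) ^ (k - i)"
      by (simp flip: power_add)
    then show "sqrt_coeff i * sqrt_coeff (k - i) =
        (- 1) ^ k * ((1/2 gchoose i) * (1/2 gchoose (k - i)))"
      by simp
  qed
  also have "(\<Sum>i\<le>k. (1/2 gchoose i) * (1/2 gchoose (k - i))) = (1 gchoose k :: real)"
    using gbinomial_Vandermonde[of "1/2" "1/2::real" k] by (simp add: atMost_atLeast0)
  also have "(1 gchoose k :: real) = of_nat (1 choose k)"
    by (metis binomial_gbinomial of_nat_1)
  finally show ?thesis
    by (cases k rule: nat.exhaust; cases "k = 1") (auto simp: binomial_eq_0)
qed

definition sqrt_series :: "'a::{real_normed_algebra_1,banach} \<Rightarrow> 'a" where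
  "sqrt_series p = (\<Sum>n. sqrt_coeff n *\<^sub>R (1 - p) ^ n)"

context
  fixes p :: "'a::{real_normed_algebra_1,banach}"
  assumes p: "norm (1 - p) \<le> 1"
begin

lemma norm_sqrt_term_le: "norm (sqrt_coeff n *\<^sub>R (1 - p) ^ n) \<le> \<bar>sqrt_coeff n\<bar>"
proof -
  have "norm ((1 - p) ^ n) \<le> 1"
    using norm_power_ineq[of "1 - p" n] power_le_one[OF norm_ge_zero p, of n] by linarith
  then show ?thesis
    by (auto simp: abs_mult power_abs intro!: mult_left_le)
qed

lemma summable_norm_sqrt_series: "summable (\<lambda>n. norm (sqrt_coeff n *\<^sub>R (1 - p) ^ n))"
proof (rule summable_norm_comparison_test)
  show "\<exists>N. \<forall>n\<ge>N. norm (sqrt_coeff n *\<^sub>R (1 - p) ^ n) \<le> \<bar>sqrt_coeff n\<bar>"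
    using norm_sqrt_term_le by blast
  show "summable (\<lambda>n. \<bar>sqrt_coeff n\<bar>)"
    by (subst summable_Suc_iff[symmetric]) (rule summable_abs_sqrt_coeff)
qed

lemma sqrt_series_sums: "(\<lambda>n. sqrt_coeff n *\<^sub>R (1 - p) ^ n) sums sqrt_series p"
  unfolding sqrt_series_def
  by (intro summable_sums summable_norm_cancel[OF summable_norm_sqrt_series])

text \<open>Absolute convergence permits the Cauchy product, which reduces to \<open>1 - x\<close>
  at \<open>x = 1 - p\<close>.\<close>

lemma sqrt_series_square: "sqrt_series p * sqrt_series p = p"
proof -
  define c where "c k = (if k = 0 then 1 else if k = 1 then - 1 else 0 :: real)" for k :: nat
  have "(\<Sum>i\<le>k. (sqrt_coeff i *\<^sub>R (1 - p) ^ i) * (sqrt_coeff (k - i) *\<^sub>R (1 - p) ^ (k - i))) =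
      c k *\<^sub>R (1 - p) ^ k" for k
  proof -
    have "(\<Sum>i\<le>k. (sqrt_coeff i *\<^sub>R (1 - p) ^ i) * (sqrt_coeff (k - i) *\<^sub>R (1 - p) ^ (k - i))) =
        (\<Sum>i\<le>k. sqrt_coeff i * sqrt_coeff (k - i)) *\<^sub>R (1 - p) ^ k"
      unfolding scaleR_left.sum
    proof (rule sum.cong[OF refl])
      fix i assume "i \<in> {..k}"
      then have "(1 - p) ^ k = (1 - p) ^ i * (1 - p) ^ (k - i)"
        by (simp flip: power_add)
      then show "(sqrt_coeff i *\<^sub>R (1 - p) ^ i) * (sqrt_coeff (k - i) *\<^sub>R (1 - p) ^ (k - i)) =
          (sqrt_coeff i * sqrt_coeff (k - i)) *\<^sub>R (1 - p) ^ k"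
        by (simp add: mult_ac)
    qed
    then show ?thesis
      by (simp only: sqrt_coeff_convolution c_def)
  qed
  then have "(\<lambda>k. c k *\<^sub>R (1 - p) ^ k) sums (sqrt_series p * sqrt_series p)"
    using Cauchy_product_sums[OF summable_norm_sqrt_series summable_norm_sqrt_series]
    unfolding sqrt_series_def by simp
  moreover have "(\<lambda>k. c k *\<^sub>R (1 - p) ^ k) sums (\<Sum>k\<in>{0, 1}. c k *\<^sub>R (1 - p) ^ k)"
    by (rule sums_finite) (auto simp: c_def)
  ultimately show ?thesis
    by (auto simp: c_def dest: sums_unique2)
qed

text \<open>Past the constant term \<open>1\<close>, the series is dominated by coefficients of
  total mass at most \<open>1\<close>. The root thus satisfies the same bound as \<open>p\<close>,
  and the construction can be iterated.\<close>

lemma norm_one_minus_sqrt_series: "norm (1 - sqrt_series p) \<le> 1"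
proof -
  let ?f = "\<lambda>n. sqrt_coeff (Suc n) *\<^sub>R (1 - p) ^ Suc n"
  have "?f sums (sqrt_series p - sqrt_coeff 0 *\<^sub>R (1 - p) ^ 0)"
    using sqrt_series_sums by (subst sums_Suc_iff) simp
  then have f: "?f sums (sqrt_series p - 1)" by simp
  have "norm (\<Sum>n. ?f n) \<le> (\<Sum>n. \<bar>sqrt_coeff (Suc n)\<bar>)"
    by (rule norm_suminf_le[OF norm_sqrt_term_le summable_abs_sqrt_coeff])
  also have "\<dots> \<le> 1"
    by (rule suminf_le_const[OF summable_abs_sqrt_coeff sum_abs_sqrt_coeff_le])
  finally show ?thesis
    by (simp only: norm_minus_commute[of 1] flip: sums_unique[OF f])
qed

text \<open>Commutation passes to each term and to the limit.\<close>

lemma sqrt_series_commute: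
  assumes "y * p = p * y"
  shows "y * sqrt_series p = sqrt_series p * y"
proof -
  have "y * (1 - p) = (1 - p) * y"
    using assms by (simp add: algebra_simps)
  then have "y * (1 - p) ^ n = (1 - p) ^ n * y" for n
    by (simp add: power_commuting_commutes)
  then have "(\<lambda>n. y * (sqrt_coeff n *\<^sub>R (1 - p) ^ n)) = (\<lambda>n. (sqrt_coeff n *\<^sub>R (1 - p) ^ n) * y)"
    by simp
  then show ?thesis
    using sums_mult[OF sqrt_series_sums, of y] sums_mult2[OF sqrt_series_sums, of y]
    by (metis sums_unique2)
qed

end

subsection \<open>Positive elements\<close>

lemma star_scaleR: "star (r *\<^sub>R x) = r *\<^sub>R star (x::'a::unital_cstar_algebra)"
  by (simp add: star_scaleC flip: scaleC_of_real)

text \<open>The C*-identity and submultiplicativity bound the norm of \<open>y\<close> by that of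
  \<open>star y\<close>; this is applied to both \<open>x\<close> and \<open>star x\<close>.\<close>

lemma norm_star: "norm (star x) = norm (x::'a::unital_cstar_algebra)"
proof -
  have le: "norm y \<le> norm (star y)" for y :: 'a
  proof (cases "y = 0")
    case False
    have "norm y * norm y \<le> norm (star y) * norm y"
      using norm_mult_ineq[of "star y" y] by (simp add: cstar_identity power2_eq_square)
    with False show ?thesis by simp
  qed simp
  show ?thesis
    using le[of x] le[of "star x"] by (simp add: star_star)
qed

lemma bounded_linear_star: "bounded_linear (star :: 'a::unital_cstar_algebra \<Rightarrow> 'a)"
  by (rule bounded_linear_intro[where K = 1]) (simp_all add: star_add star_scaleR norm_star)

lemma star_0 [simp]: "star (0::'a::unital_cstar_algebra) = 0"
  by (rule linear_0[OF bounded_linear.linear[OF bounded_linear_star]])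

lemma star_minus: "star (- x) = - star (x::'a::unital_cstar_algebra)"
  by (rule linear_neg[OF bounded_linear.linear[OF bounded_linear_star]])

lemma star_diff: "star (x - y) = star x - star (y::'a::unital_cstar_algebra)"
  by (rule linear_diff[OF bounded_linear.linear[OF bounded_linear_star]])

lemma star_1 [simp]: "star 1 = (1::'a::unital_cstar_algebra)"
  by (metis mult.right_neutral star_mult star_star)

lemma star_power: "star (x ^ n) = star (x::'a::unital_cstar_algebra) ^ n"
  by (induction n) (simp_all add: star_mult power_commutes)

lemma star_mult_self_eq_0: "star x * x = 0 \<Longrightarrow> x = (0::'a::unital_cstar_algebra)"
  using cstar_identity[of x] by simp

lemma scaleC_i_i: "\<i> *\<^sub>C \<i> *\<^sub>C x = - (x::'a::unital_cstar_algebra)"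
  using scaleC_of_real[of "- 1" x] by (simp add: scaleC_scaleC)

lemma scaleC_minus_left: "(- c) *\<^sub>C x = - (c *\<^sub>C (x::'a::unital_cstar_algebra))"
proof -
  have "(- c) *\<^sub>C x + c *\<^sub>C x = 0"
    using scaleC_of_real[of 0 x] by (simp flip: scaleC_add_left)
  then show ?thesis by (simp add: eq_neg_iff_add_eq_0)
qed

lemma scaleC_0_right [simp]: "c *\<^sub>C 0 = (0::'a::unital_cstar_algebra)"
  using scaleC_add_right[of c 0 0] by simp

lemma scaleC_minus_right: "c *\<^sub>C (- x) = - (c *\<^sub>C (x::'a::unital_cstar_algebra))"
  using scaleC_add_right[of c x "- x"] by (simp add: eq_neg_iff_add_eq_0 add.commute)

lemma scaleC_diff_right: "c *\<^sub>C (x - y) = c *\<^sub>C x - c *\<^sub>C (y::'a::unital_cstar_algebra)"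
  using scaleC_add_right[of c x "- y"] by (simp add: scaleC_minus_right)

lemma star_scaleC_i: "star (\<i> *\<^sub>C x) = - (\<i> *\<^sub>C star (x::'a::unital_cstar_algebra))"
  by (simp add: star_scaleC scaleC_minus_left)

lemma star_sqrt_series:
  fixes p :: "'a::unital_cstar_algebra"
  assumes "norm (1 - p) \<le> 1" and "star p = p"
  shows "star (sqrt_series p) = sqrt_series p"
proof -
  have "(\<lambda>n. star (sqrt_coeff n *\<^sub>R (1 - p) ^ n)) sums star (sqrt_series p)"
    by (rule bounded_linear.sums[OF bounded_linear_star sqrt_series_sums[OF assms(1)]])
  then show ?thesis
    using sqrt_series_sums[OF assms(1)] assms(2)
    by (simp add: star_scaleR star_power star_diff sums_unique2)
qed

text \<open>The mixed terms cancel because \<open>c\<close> and \<open>h\<close> commute.\<close>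

lemma star_mult_add_i:
  fixes c h :: "'a::unital_cstar_algebra"
  assumes "star c = c" "star h = h" "c * h = h * c"
  shows "star (c + \<i> *\<^sub>C h) * (c + \<i> *\<^sub>C h) = c * c + h * h"
  using assms
  by (simp add: star_add star_scaleC_i algebra_simps mult_scaleC_left mult_scaleC_right scaleC_i_i
      scaleC_add_right scaleC_diff_right)

text \<open>With \<open>c = sqrt (1 - h\<^sup>2)\<close> the element \<open>c + i h\<close> is unitary and \<open>c\<close> is its real part, so
  \<open>\<parallel>c\<parallel> \<le> 1\<close>.\<close>

lemma norm_one_minus_square_le:
  fixes h :: "'a::unital_cstar_algebra"
  assumes h: "star h = h" and "norm h \<le> 1"
  shows "norm (1 - h * h) \<le> 1"
proof -
  define c where "c = sqrt_series (1 - h * h)"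
  have "norm (h * h) \<le> 1"
    using norm_mult_ineq[of h h] mult_le_one[OF assms(2) norm_ge_zero assms(2)] by linarith
  then have *: "norm (1 - (1 - h * h)) \<le> 1" by simp
  have c: "star c = c" "c * c = 1 - h * h" "c * h = h * c"
    unfolding c_def
    using star_sqrt_series[OF *] sqrt_series_square[OF *] sqrt_series_commute[OF *, of h] h
    by (simp_all add: star_diff star_mult algebra_simps)
  let ?u = "c + \<i> *\<^sub>C h"
  have "star ?u * ?u = 1"
    using star_mult_add_i[OF c(1) h c(3)] c(2) by simp
  then have "norm ?u = 1"
    using cstar_identity[of ?u] by (simp add: power2_eq_1_iff) (smt (verit) norm_ge_zero)
  have "2 *\<^sub>R c = ?u + star ?u"
    using c(1) h by (simp add: star_add star_scaleC_i scaleR_2)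
  then have "2 * norm c \<le> norm ?u + norm (star ?u)"
    using norm_triangle_ineq[of ?u "star ?u"] by (metis abs_numeral norm_scaleR)
  then have "norm c \<le> 1"
    using \<open>norm ?u = 1\<close> by (simp add: norm_star)
  then show ?thesis
    using norm_mult_ineq[of c c] mult_le_one[of "norm c" "norm c"] by (simp add: c(2))
qed

text \<open>Nonnegativity of the spectrum, phrased so that \<open>sqrt_series\<close> applies to a
  positive multiple of \<open>p\<close>.\<close>

definition positive_element :: "'a::unital_cstar_algebra \<Rightarrow> bool" where
  "positive_element p \<longleftrightarrow> star p = p \<and> (\<exists>t>0. norm (1 - t *\<^sub>R p) \<le> 1)"

text \<open>The third property places the root in the bicommutant of \<open>p\<close>.\<close>

lemma positive_element_sqrt:
  fixes p :: "'a::unital_cstar_algebra"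
  assumes "positive_element p"
  obtains r where "star r = r" "r * r = p" "\<And>y. y * p = p * y \<Longrightarrow> y * r = r * y"
proof -
  obtain t where p: "star p = p" and t: "t > 0" "norm (1 - t *\<^sub>R p) \<le> 1"
    using assms by (auto simp: positive_element_def)
  define r where "r = (1 / sqrt t) *\<^sub>R sqrt_series (t *\<^sub>R p)"
  show ?thesis
  proof
    show "star r = r"
      using star_sqrt_series[OF t(2)] p by (simp add: r_def star_scaleR)
    show "r * r = p"
      using sqrt_series_square[OF t(2)] t(1) by (simp add: r_def)
    show "y * r = r * y" if "y * p = p * y" for y
      using sqrt_series_commute[OF t(2), of y] that by (simp add: r_def)
  qed
qed

lemma positive_element_square:
  fixes h :: "'a::unital_cstar_algebra"
  assumes "star h = h"
  shows "positive_element (h * h)"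
proof (cases "h = 0")
  case True
  then show ?thesis by (auto simp: positive_element_def intro!: exI[of _ 1])
next
  case False
  define t where "t = 1 / norm h"
  have "norm (1 - (t *\<^sub>R h) * (t *\<^sub>R h)) \<le> 1"
    using assms False by (intro norm_one_minus_square_le) (simp_all add: star_scaleR t_def)
  then have "norm (1 - (t * t) *\<^sub>R (h * h)) \<le> 1" by simp
  moreover have "t * t > 0" using False by (simp add: t_def)
  ultimately show ?thesis
    using assms by (auto simp: positive_element_def star_mult)
qed

text \<open>The weights \<open>a\<close> and \<open>b\<close> satisfy \<open>a * t = b * s\<close>,
  so the convex combination of \<open>1 - t *\<^sub>R p\<close> and \<open>1 - s *\<^sub>R q\<close>
  is \<open>1\<close> minus a multiple of \<open>p + q\<close>.\<close>

lemma positive_element_add: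
  fixes p q :: "'a::unital_cstar_algebra"
  assumes "positive_element p" "positive_element q"
  shows "positive_element (p + q)"
proof -
  obtain t s where pq: "star p = p" "star q = q"
    and t: "t > 0" "norm (1 - t *\<^sub>R p) \<le> 1" and s: "s > 0" "norm (1 - s *\<^sub>R q) \<le> 1"
    using assms by (auto simp: positive_element_def)
  define a b where "a = s / (s + t)" and "b = t / (s + t)"
  have ab: "a \<ge> 0" "b \<ge> 0" "a + b = 1" "a * t = s * t / (s + t)" "b * s = s * t / (s + t)"
    using t(1) s(1) by (simp_all add: a_def b_def mult.commute flip: add_divide_distrib)
  have "1 - (s * t / (s + t)) *\<^sub>R (p + q) = (a + b) *\<^sub>R 1 - (a * t) *\<^sub>R p - (b * s) *\<^sub>R q"
    by (simp add: ab scaleR_right_distrib)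
  also have "\<dots> = a *\<^sub>R (1 - t *\<^sub>R p) + b *\<^sub>R (1 - s *\<^sub>R q)"
    by (simp add: algebra_simps)
  also have "norm \<dots> \<le> a * norm (1 - t *\<^sub>R p) + b * norm (1 - s *\<^sub>R q)"
    using ab by (intro order_trans[OF norm_triangle_ineq]) simp
  also have "\<dots> \<le> 1"
    using ab t s convex_bound_le[of _ 1 _ a b] by blast
  finally have "norm (1 - (s * t / (s + t)) *\<^sub>R (p + q)) \<le> 1" .
  moreover have "s * t / (s + t) > 0" using t s by simp
  ultimately show ?thesis
    using pq by (auto simp: positive_element_def star_add)
qed

text \<open>The roots \<open>k\<close> of \<open>p\<close> and \<open>l\<close> of
  \<open>- p\<close> commute, so \<open>k + i l\<close> has "absolute square"
  \<open>p - p = 0\<close> and vanishes; so does its adjoint, whence \<open>k = 0\<close>.\<close>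

lemma positive_element_antisym:
  fixes p :: "'a::unital_cstar_algebra"
  assumes "positive_element p" "positive_element (- p)"
  shows "p = 0"
proof -
  obtain k where k: "star k = k" "k * k = p" "\<And>y. y * p = p * y \<Longrightarrow> y * k = k * y"
    using positive_element_sqrt[OF assms(1)] by metis
  obtain l where l: "star l = l" "l * l = - p" "\<And>y. y * (- p) = (- p) * y \<Longrightarrow> y * l = l * y"
    using positive_element_sqrt[OF assms(2)] by metis
  have "k * p = p * k" by (simp add: mult.assoc flip: k(2))
  then have "k * l = l * k" using l(3)[of k] by simp
  then have "star (k + \<i> *\<^sub>C l) * (k + \<i> *\<^sub>C l) = 0"
    using star_mult_add_i[OF k(1) l(1)] k(2) l(2) by simp
  then have "k + \<i> *\<^sub>C l = 0" by (rule star_mult_self_eq_0)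
  moreover from this have "k - \<i> *\<^sub>C l = 0"
    using k(1) l(1) star_0 by (metis add_uminus_conv_diff star_add star_scaleC_i)
  ultimately have "k + k = 0" by (simp add: add_eq_0_iff)
  then have "k = 0" by (simp flip: scaleR_2)
  then show ?thesis using k(2) by simp
qed

text \<open>If \<open>x\<^sup>* x = - m\<^sup>2\<close>, then \<open>y = x m\<close> satisfies \<open>y\<^sup>* y = - m\<^sup>4\<close> and \<open>y y\<^sup>* = - (x x\<^sup>*)\<^sup>2\<close>, while
  \<open>y\<^sup>* y + y y\<^sup>*\<close> is a sum of squares of self-adjoint elements.\<close>

lemma star_mult_self_eq_minus_square:
  fixes x m :: "'a::unital_cstar_algebra"
  assumes m: "star m = m" and x: "star x * x = - (m * m)"
  shows "m = 0"
proof -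
  define y where "y = x * m"
  define q where "q = x * star x"
  define u where "u = y + star y"
  define w where "w = \<i> *\<^sub>C (y - star y)"
  define p where "p = (m * m) * (m * m)"
  have sa: "star q = q" "star u = u" "star w = w"
    by (simp_all add: q_def u_def w_def star_mult star_add star_star star_scaleC_i star_diff
        add.commute flip: scaleC_minus_right)
  have "star y * y = m * (star x * x) * m"
    by (simp add: y_def star_mult m mult.assoc)
  then have yy: "star y * y = - p"
    by (simp add: x p_def mult.assoc)
  have "y * star y = x * (m * m) * star x"
    by (simp add: y_def star_mult m mult.assoc)
  also have "\<dots> = - (x * (star x * x) * star x)"
    by (simp add: x)
  finally have yy': "y * star y = - (q * q)"
    by (simp add: q_def mult.assoc)
  have "w * w = - ((y - star y) * (y - star y))"
    by (simp add: w_def mult_scaleC_left mult_scaleC_right scaleC_i_i)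
  then have "u * u + w * w = 2 *\<^sub>R (star y * y + y * star y)"
    by (simp add: u_def scaleR_2 algebra_simps)
  then have "u * u + w * w = - p - q * q + (- p - q * q)"
    by (simp add: yy yy' scaleR_2)
  \<comment> \<open>The two expressions for \<open>u * u + w * w\<close> exhibit \<open>- p\<close>
    as a sum of members of the cone.\<close>
  then have "- p = p + q * q + q * q + (u * u + w * w)"
    by simp
  moreover have p: "positive_element p"
    unfolding p_def by (rule positive_element_square) (simp add: star_mult m)
  ultimately have "positive_element (- p)"
    using sa by (simp add: positive_element_add positive_element_square)
  with p have "p = 0" by (rule positive_element_antisym)
  then have "star (m * m) * (m * m) = 0" by (simp add: p_def star_mult m)
  then have "star m * m = 0" using star_mult_self_eq_0[of "m * m"] by (simp add: m)
  then show ?thesis by (rule star_mult_self_eq_0)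
qed

lemma positive_element_scaleR:
  fixes p :: "'a::unital_cstar_algebra"
  assumes "positive_element p" "r > 0"
  shows "positive_element (r *\<^sub>R p)"
proof -
  obtain t where "star p = p" "t > 0" "norm (1 - t *\<^sub>R p) \<le> 1"
    using assms(1) by (auto simp: positive_element_def)
  with assms(2) show ?thesis
    unfolding positive_element_def by (auto simp: star_scaleR intro!: exI[of _ "t / r"])
qed

text \<open>Let \<open>g\<close> be \<open>a\<^sup>* a\<close>, rescaled so that \<open>k = sqrt (g\<^sup>2)\<close> is given by the series. With \<open>l = sqrt k\<close>, the
  element \<open>n = k - g\<close>, twice the negative part of \<open>g\<close>, satisfies \<open>n g n = - n k n = - (l n)\<^sup>2\<close>.\<close>

lemma positive_element_star_mult_self:
  fixes a :: "'a::unital_cstar_algebra"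
  shows "positive_element (star a * a)"
proof -
  define h where "h = star a * a"
  have h: "star h = h" by (simp add: h_def star_mult star_star)
  obtain t where t: "t > 0" "norm (1 - t *\<^sub>R (h * h)) \<le> 1"
    using positive_element_square[OF h] by (auto simp: positive_element_def)
  define k where "k = sqrt_series (t *\<^sub>R (h * h))"
  define g where "g = sqrt t *\<^sub>R h"
  have g: "star g = g" by (simp add: g_def star_scaleR h)
  have gg: "g * g = t *\<^sub>R (h * h)" using t(1) by (simp add: g_def)
  have k: "star k = k" "k * k = g * g" "norm (1 - k) \<le> 1" "g * k = k * g"
    unfolding k_def using t(2) g
    by (simp_all add: star_sqrt_series sqrt_series_square norm_one_minus_sqrt_series
        sqrt_series_commute star_mult mult.assoc flip: gg)
  \<comment> \<open>The norm bound on \<open>1 - k\<close> is the definition with scale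
    \<open>1\<close>; this allows a second root \<open>l\<close>.\<close>
  have "positive_element k"
    unfolding positive_element_def using k by (auto intro!: exI[of _ 1])
  then obtain l where l: "star l = l" "l * l = k" "\<And>y. y * k = k * y \<Longrightarrow> y * l = l * y"
    using positive_element_sqrt by metis
  define n where "n = k - g"
  have n: "star n = n" by (simp add: n_def star_diff k g)
  have nk: "n * k = k * n" by (simp add: n_def algebra_simps k)
  then have nl: "n * l = l * n" by (rule l(3))
  have gn: "g * n = - (k * n)"
    by (simp add: n_def algebra_simps k)
  define m where "m = l * n"
  \<comment> \<open>The scalar contributes \<open>sqrt t\<close> to \<open>star x * x\<close>,
    turning \<open>n * h * n\<close> into \<open>n * g * n\<close>.\<close>
  define x where "x = sqrt (sqrt t) *\<^sub>R (a * n)"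
  have "star x * x = n * g * n"
    using t(1) by (simp add: x_def star_scaleR star_mult n g_def h_def mult.assoc)
  also have "\<dots> = - (n * k * n)"
    by (simp add: mult.assoc gn)
  also have "n * k * n = m * m"
    by (metis m_def l(2) nl mult.assoc)
  finally have "star x * x = - (m * m)" .
  moreover have "star m = m" by (simp add: m_def star_mult l n nl)
  ultimately have "m = 0" using star_mult_self_eq_minus_square by blast
  then have "k * n = 0" by (metis m_def l(2) mult.assoc mult_zero_right)
  with gn have "g * n = 0" by simp
  \<comment> \<open>Here \<open>n * n = k * n - g * n\<close>; so \<open>n = 0\<close>, and
    \<open>g\<close> equals the positive element \<open>k\<close>.\<close>
  have "star n * n = 0"
    using \<open>k * n = 0\<close> \<open>g * n = 0\<close> n by (metis n_def left_diff_distrib diff_self)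
  then have "n = 0" by (rule star_mult_self_eq_0)
  then have "positive_element g" using \<open>positive_element k\<close> by (simp add: n_def)
  then have "positive_element ((1 / sqrt t) *\<^sub>R g)"
    using t(1) by (intro positive_element_scaleR) auto
  then show ?thesis using t(1) by (simp add: g_def h_def)
qed

subsection \<open>Quasi-states and compatible families of states\<close>

text \<open>Serves for self-adjoint \<open>h\<close> as a canonical commutative subalgebra
  containing \<open>h\<close>, in place of the generated one.\<close>

definition bicommutant :: "'a::unital_cstar_algebra \<Rightarrow> 'a set" where
  "bicommutant h = {x. \<forall>y. y * h = h * y \<longrightarrow> y * x = x * y}"

lemma self_in_bicommutant: "h \<in> bicommutant h"
  by (simp add: bicommutant_def)

text \<open>The commutant of a self-adjoint \<open>h\<close> is closed under \<open>star\<close>,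
  hence so is the bicommutant. Since \<open>h\<close> commutes with itself, members of the
  bicommutant commute with \<open>h\<close>, and therefore with each other.\<close>

lemma bicommutant_in_comm_subalgebras:
  fixes h :: "'a::unital_cstar_algebra"
  assumes h: "star h = h"
  shows "bicommutant h \<in> comm_subalgebras"
proof -
  have star_closed: "star x \<in> bicommutant h" if "x \<in> bicommutant h" for x
    unfolding bicommutant_def
  proof (intro CollectI allI impI)
    fix y assume "y * h = h * y"
    then have "star y * h = h * star y"
      by (metis h star_mult)
    then have "star y * x = x * star y"
      using that by (simp add: bicommutant_def)
    then show "y * star x = star x * y"
      by (metis star_mult star_star)
  qed
  have mult_closed: "x * x' \<in> bicommutant h" if "x \<in> bicommutant h" "x' \<in> bicommutant h" for x x'
    unfolding bicommutant_def
  proof (intro CollectI allI impI)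
    fix y assume "y * h = h * y"
    then have "y * x = x * y" "y * x' = x' * y"
      using that by (simp_all add: bicommutant_def)
    then show "y * (x * x') = x * x' * y"
      by (metis mult.assoc)
  qed
  have "bicommutant h = (\<Inter>y\<in>{y. y * h = h * y}. {x. y * x = x * y})"
    by (auto simp: bicommutant_def)
  then have "closed (bicommutant h)"
    by (auto intro!: closed_INT closed_Collect_eq continuous_intros)
  moreover have "x * x' = x' * x" if "x \<in> bicommutant h" "x' \<in> bicommutant h" for x x'
  proof -
    have "h * x' = x' * h" using that(2) by (simp add: bicommutant_def)
    then have "x' * h = h * x'" by simp
    then show ?thesis using that(1) by (simp add: bicommutant_def)
  qed
  moreover have "1 \<in> bicommutant h"
    "\<And>x x'. x \<in> bicommutant h \<Longrightarrow> x' \<in> bicommutant h \<Longrightarrow> x + x' \<in> bicommutant h"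
    "\<And>c x. x \<in> bicommutant h \<Longrightarrow> c *\<^sub>C x \<in> bicommutant h"
    by (simp_all add: bicommutant_def ring_distribs mult_scaleC_left mult_scaleC_right)
  ultimately show ?thesis
    using star_closed mult_closed
    by (simp add: comm_subalgebras_def unital_cstar_subalgebra_def)
qed

lemma Int_comm_subalgebras:
  "A \<in> comm_subalgebras \<Longrightarrow> B \<in> comm_subalgebras \<Longrightarrow> A \<inter> B \<in> comm_subalgebras"
  by (auto simp: comm_subalgebras_def unital_cstar_subalgebra_def)

lemma comm_subalgebrasD:
  assumes "B \<in> comm_subalgebras"
  shows "1 \<in> B" "x \<in> B \<Longrightarrow> y \<in> B \<Longrightarrow> x + y \<in> B" "x \<in> B \<Longrightarrow> c *\<^sub>C x \<in> B"
    "x \<in> B \<Longrightarrow> y \<in> B \<Longrightarrow> x * y \<in> B" "x \<in> B \<Longrightarrow> star x \<in> B"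
  using assms by (auto simp: comm_subalgebras_def unital_cstar_subalgebra_def)

section \<open>Real and imaginary parts\<close>

definition re_part :: "'a::unital_cstar_algebra \<Rightarrow> 'a" where
  "re_part a = complex_of_real (1/2) *\<^sub>C (a + star a)"

definition im_part :: "'a::unital_cstar_algebra \<Rightarrow> 'a" where
  "im_part a = re_part ((- \<i>) *\<^sub>C a)"

lemma star_re_part: "star (re_part a) = re_part a"
  by (simp add: re_part_def star_scaleC star_add star_star add.commute)

lemma star_im_part: "star (im_part a) = im_part a"
  by (simp add: im_part_def star_re_part)

lemma re_part_add_im_part: "re_part a + \<i> *\<^sub>C im_part a = a"
proof -
  have "\<i> *\<^sub>C im_part a = complex_of_real (1/2) *\<^sub>C (a - star a)"
    unfolding im_part_def re_part_def star_scaleC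
    by (simp add: scaleC_scaleC scaleC_add_right scaleC_diff_right scaleC_minus_left
        del: of_real_divide)
       (simp add: scaleC_minus_left)
  then have "re_part a + \<i> *\<^sub>C im_part a = complex_of_real (1/2) *\<^sub>C (a + a)"
    by (simp add: re_part_def flip: scaleC_add_right)
  also have "\<dots> = a"
    by (simp only: scaleC_of_real) (simp flip: scaleR_2)
  finally show ?thesis .
qed

text \<open>The second equation is the first one for \<open>b + i (- a)\<close>, which is
  \<open>- i\<close> times \<open>a + i b\<close>.\<close>

lemma re_im_part_add:
  assumes "star a = a" "star b = b"
  shows "re_part (a + \<i> *\<^sub>C b) = a" "im_part (a + \<i> *\<^sub>C b) = b"
proof -
  have half: "complex_of_real (1/2) *\<^sub>C (x + x) = x" for x :: 'a
    by (simp only: scaleC_of_real) (simp flip: scaleR_2)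
  have re: "re_part (x + \<i> *\<^sub>C y) = x" if "star x = x" "star y = y" for x y :: 'a
  proof -
    have "x + \<i> *\<^sub>C y + star (x + \<i> *\<^sub>C y) = x + x"
      using that by (simp add: star_add star_scaleC_i)
    then show ?thesis by (simp only: re_part_def half)
  qed
  show "re_part (a + \<i> *\<^sub>C b) = a" by (rule re[OF assms])
  have "(- \<i>) *\<^sub>C (a + \<i> *\<^sub>C b) = b + \<i> *\<^sub>C (- a)"
    by (simp add: scaleC_minus_left scaleC_add_right scaleC_i_i scaleC_minus_right)
  then show "im_part (a + \<i> *\<^sub>C b) = b"
    unfolding im_part_def using re[of b "- a"] assms by (simp add: star_minus)
qed

lemma re_im_part_closed:
  assumes "B \<in> comm_subalgebras" "a \<in> B"
  shows "re_part a \<in> B" "im_part a \<in> B"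
  using assms by (simp_all add: re_part_def im_part_def comm_subalgebrasD del: of_real_divide)

section \<open>Restricting quasi-states and gluing compatible families\<close>

lemma restrictions_apply [simp]:
  "B \<in> comm_subalgebras \<Longrightarrow> f \<in> B \<Longrightarrow> restrictions \<mu> B f = \<mu> f"
  by (simp add: restrictions_def)

lemma restrict_in_states:
  assumes "\<mu> \<in> quasi_states" "B \<in> comm_subalgebras"
  shows "restrict \<mu> B \<in> states B"
  using assms by (auto simp: states_def quasi_states_def clinear_on_def comm_subalgebrasD)

lemma restrictions_in_QS:
  assumes "\<mu> \<in> quasi_states"
  shows "restrictions \<mu> \<in> QS"
  using assms restrict_in_states[OF assms]
  by (auto simp: QS_def restrictions_def Int_absorb1 restrict_restrict)

text \<open>A quasi-state is determined by its values on self-adjoint elements, each of which lies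
  in its own bicommutant.\<close>

lemma inj_on_restrictions:
  "inj_on restrictions (quasi_states :: ('a::unital_cstar_algebra \<Rightarrow> complex) set)"
proof (rule inj_onI, rule ext)
  fix \<mu> \<nu> :: "'a \<Rightarrow> complex" and a :: 'a
  assume \<mu>: "\<mu> \<in> quasi_states" and \<nu>: "\<nu> \<in> quasi_states" and eq: "restrictions \<mu> = restrictions \<nu>"
  have sa: "\<mu> b = \<nu> b" if "star b = b" for b
    using eq restrictions_apply[OF bicommutant_in_comm_subalgebras[OF that] self_in_bicommutant]
    by metis
  have split: "\<rho> a = \<rho> (re_part a) + \<i> * \<rho> (im_part a)" if "\<rho> \<in> quasi_states" for \<rho>
  proof -
    have "\<rho> (re_part a + \<i> *\<^sub>C im_part a) = \<rho> (re_part a) + \<i> * \<rho> (im_part a)"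
      using that by (simp add: quasi_states_def self_adjoint_def star_re_part star_im_part)
    then show ?thesis by (simp only: re_part_add_im_part)
  qed
  show "\<mu> a = \<nu> a"
    by (simp only: split[OF \<mu>] split[OF \<nu>] sa[OF star_re_part] sa[OF star_im_part])
qed

text \<open>Both sides are compared on \<open>A \<inter> B\<close>, itself an index of the
  family.\<close>

lemma QS_consistent:
  assumes "m \<in> QS" "A \<in> comm_subalgebras" "B \<in> comm_subalgebras" "f \<in> A" "f \<in> B"
  shows "m A f = m B f"
proof -
  have "restrict (m A) (A \<inter> B) = m (A \<inter> B)" "restrict (m B) (A \<inter> B) = m (A \<inter> B)"
    using assms(1) Int_comm_subalgebras[OF assms(2,3)] assms(2,3) unfolding QS_def by blast+
  then show ?thesis using assms(4,5) by (metis IntI restrict_apply')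
qed

text \<open>The two parts of \<open>a\<close> need not commute, so each is evaluated in a subalgebra
  of its own.\<close>

definition glue :: "('a::unital_cstar_algebra set \<Rightarrow> 'a \<Rightarrow> complex) \<Rightarrow> 'a \<Rightarrow> complex" where
  "glue m a = m (bicommutant (re_part a)) (re_part a) + \<i> * m (bicommutant (im_part a)) (im_part a)"

lemma QS_statesD:
  assumes "m \<in> QS" "B \<in> comm_subalgebras"
  shows "m B \<in> states B"
  using assms by (auto simp: QS_def)

lemma statesD:
  assumes "\<phi> \<in> states B"
  shows "\<phi> \<in> extensional B" "x \<in> B \<Longrightarrow> y \<in> B \<Longrightarrow> \<phi> (x + y) = \<phi> x + \<phi> y"
    "x \<in> B \<Longrightarrow> \<phi> (c *\<^sub>C x) = c * \<phi> x" "x \<in> B \<Longrightarrow> \<phi> (star x * x) \<in> \<real>\<^sub>\<ge>\<^sub>0" "\<phi> 1 = 1"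
  using assms by (auto simp: states_def clinear_on_def)

text \<open>Both parts of \<open>a\<close> lie in \<open>B\<close>, so consistency moves their
  evaluation to \<open>B\<close>, where linearity recombines them.\<close>

lemma glue_eq:
  assumes m: "m \<in> QS" and B: "B \<in> comm_subalgebras" "a \<in> B"
  shows "glue m a = m B a"
proof -
  have *: "m (bicommutant h) h = m B h" if "star h = h" "h \<in> B" for h
    using QS_consistent[OF m bicommutant_in_comm_subalgebras B(1) self_in_bicommutant] that by blast
  have "glue m a = m B (re_part a) + \<i> * m B (im_part a)"
    using * re_im_part_closed[OF B] by (simp add: glue_def star_re_part star_im_part)
  also have "\<dots> = m B (re_part a + \<i> *\<^sub>C im_part a)"
    using statesD[OF QS_statesD[OF m B(1)]] re_im_part_closed[OF B] comm_subalgebrasD(3)[OF B(1)]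
    by simp
  finally show ?thesis by (simp only: re_part_add_im_part)
qed

lemma glue_in_quasi_states:
  fixes m :: "'a::unital_cstar_algebra set \<Rightarrow> 'a \<Rightarrow> complex"
  assumes m: "m \<in> QS"
  shows "glue m \<in> quasi_states"
  unfolding quasi_states_def
proof (intro CollectI conjI ballI allI impI)
  fix B :: "'a set" assume B: "B \<in> comm_subalgebras"
  then show "clinear_on B (glue m)"
    using glue_eq[OF m B] statesD[OF QS_statesD[OF m B]] comm_subalgebrasD[OF B]
    by (simp add: clinear_on_def)
next
  fix a b :: 'a assume "self_adjoint a \<and> self_adjoint b"
  then have ab: "star a = a" "star b = b" by (simp_all add: self_adjoint_def)
  have "glue m h = m (bicommutant h) h" if "star h = h" for h
    by (rule glue_eq[OF m bicommutant_in_comm_subalgebras[OF that] self_in_bicommutant])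
  with ab show "glue m (a + \<i> *\<^sub>C b) = glue m a + \<i> * glue m b"
    by (simp add: glue_def[of m "a + \<i> *\<^sub>C b"] re_im_part_add)
next
  fix a :: 'a
  \<comment> \<open>Possibly no commutative subalgebra contains \<open>a\<close>; the self-adjoint
    \<open>r\<close> replaces it, giving \<open>star r * r = star a * a\<close> inside the
    bicommutant.\<close>
  obtain r where r: "star r = r" "r * r = star a * a"
    "\<And>y. y * (star a * a) = (star a * a) * y \<Longrightarrow> y * r = r * y"
    using positive_element_sqrt[OF positive_element_star_mult_self[of a]] by metis
  let ?B = "bicommutant (star a * a)"
  have B: "?B \<in> comm_subalgebras"
    by (rule bicommutant_in_comm_subalgebras) (simp add: star_mult star_star)
  have "r \<in> ?B" using r(3) by (simp add: bicommutant_def)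
  then have "m ?B (star r * r) \<in> \<real>\<^sub>\<ge>\<^sub>0"
    by (rule statesD(4)[OF QS_statesD[OF m B]])
  then show "glue m (star a * a) \<in> \<real>\<^sub>\<ge>\<^sub>0"
    by (simp only: r(1,2) glue_eq[OF m B self_in_bicommutant])
next
  have B: "bicommutant (1::'a) \<in> comm_subalgebras"
    by (rule bicommutant_in_comm_subalgebras) simp
  then show "glue m 1 = 1"
    using glue_eq[OF m B self_in_bicommutant] statesD(5)[OF QS_statesD[OF m B]] by simp
qed

lemma restrictions_glue:
  assumes m: "m \<in> QS"
  shows "restrictions (glue m) = m"
proof (rule extensionalityI)
  show "restrictions (glue m) \<in> extensional comm_subalgebras" by (simp add: restrictions_def)
  show "m \<in> extensional comm_subalgebras" using m by (auto simp: QS_def PiE_def)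
  fix B :: "'a set" assume B: "B \<in> comm_subalgebras"
  show "restrictions (glue m) B = m B"
  proof (rule extensionalityI)
    show "restrictions (glue m) B \<in> extensional B" using B by (simp add: restrictions_def)
    show "m B \<in> extensional B" by (rule statesD(1)[OF QS_statesD[OF m B]])
  qed (simp add: B glue_eq[OF m])
qed

lemma bij_betw_restrictions: "bij_betw restrictions quasi_states QS"
  unfolding bij_betw_def
proof
  show "restrictions ` quasi_states = QS"
  proof (intro subset_antisym image_subsetI subsetI)
    show "m \<in> restrictions ` quasi_states" if "m \<in> QS" for m
      using restrictions_glue[OF that] glue_in_quasi_states[OF that] by (rule image_eqI[OF sym])
  qed (rule restrictions_in_QS)
qed (rule inj_on_restrictions)

section \<open>Convex structure\<close>

lemma nonneg_Reals_convex_combination: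
  assumes "t \<in> {0..1}" "z \<in> \<real>\<^sub>\<ge>\<^sub>0" "w \<in> \<real>\<^sub>\<ge>\<^sub>0"
  shows "(1 - t) *\<^sub>R z + t *\<^sub>R w \<in> (\<real>\<^sub>\<ge>\<^sub>0 :: complex set)"
  using assms by (auto simp: complex_nonneg_Reals_iff)

lemma clinear_on_combination:
  assumes "clinear_on B \<phi>" "clinear_on B \<psi>"
  shows "clinear_on B (\<lambda>a. (1 - t) *\<^sub>R \<phi> a + t *\<^sub>R \<psi> a)"
  using assms by (auto simp: clinear_on_def algebra_simps)

lemma quasi_states_combination:
  fixes \<mu> \<nu> :: "'a::unital_cstar_algebra \<Rightarrow> complex"
  assumes "t \<in> {0..1}" "\<mu> \<in> quasi_states" "\<nu> \<in> quasi_states"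
  shows "(\<lambda>a. (1 - t) *\<^sub>R \<mu> a + t *\<^sub>R \<nu> a) \<in> quasi_states"
  unfolding quasi_states_def
proof (intro CollectI conjI ballI allI impI)
  fix a b :: 'a assume "self_adjoint a \<and> self_adjoint b"
  then have "\<mu> (a + \<i> *\<^sub>C b) = \<mu> a + \<i> * \<mu> b" "\<nu> (a + \<i> *\<^sub>C b) = \<nu> a + \<i> * \<nu> b"
    using assms by (auto simp: quasi_states_def)
  then show "(1 - t) *\<^sub>R \<mu> (a + \<i> *\<^sub>C b) + t *\<^sub>R \<nu> (a + \<i> *\<^sub>C b) =
      (1 - t) *\<^sub>R \<mu> a + t *\<^sub>R \<nu> a + \<i> * ((1 - t) *\<^sub>R \<mu> b + t *\<^sub>R \<nu> b)"
    by (simp add: algebra_simps)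
next
  show "(1 - t) *\<^sub>R \<mu> 1 + t *\<^sub>R \<nu> 1 = 1"
    using assms by (simp add: quasi_states_def flip: scaleR_left_distrib)
qed (use assms in \<open>auto simp: quasi_states_def
    intro: clinear_on_combination nonneg_Reals_convex_combination\<close>)

lemma restrictions_combination:
  "restrictions (\<lambda>a. (1 - t) *\<^sub>R \<mu> a + t *\<^sub>R \<nu> a)
     = QS_combination t (restrictions \<mu>) (restrictions \<nu>)"
  unfolding QS_combination_def restrictions_def
  by (intro restrict_ext) simp

text \<open>Convexity is transported from quasi-states through \<open>glue\<close>.\<close>

lemma QS_combination_in_QS:
  assumes "t \<in> {0..1}" "m \<in> QS" "n \<in> QS"
  shows "QS_combination t m n \<in> QS"
proof -
  have "QS_combination t m n =
      restrictions (\<lambda>a. (1 - t) *\<^sub>R glue m a + t *\<^sub>R glue n a)"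
    using assms by (simp add: restrictions_combination restrictions_glue)
  then show ?thesis
    using assms by (simp add: restrictions_in_QS quasi_states_combination glue_in_quasi_states)
qed

section \<open>Projective topology\<close>

lemma topspace_state_space: "topspace (state_space B) = states B"
  by (auto simp: state_space_def states_def PiE_UNIV_domain PiE_def)

lemma topspace_QS_topology: "topspace QS_topology = QS"
  by (auto simp: QS_topology_def QS_def topspace_state_space)

lemma topspace_pullback_restrictions:
  "topspace (pullback_topology quasi_states restrictions QS_topology) = quasi_states"
  using restrictions_in_QS by (auto simp: topspace_pullback_topology topspace_QS_topology)

lemma continuous_map_QS_topology_eval:
  assumes "B \<in> comm_subalgebras" "f \<in> B"
  shows "continuous_map QS_topology euclidean (\<lambda>m. m B f)"
proof -
  have "continuous_map QS_topology (state_space B) (\<lambda>m. m B)"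
    unfolding QS_topology_def
    by (intro continuous_map_from_subtopology continuous_map_product_projection assms)
  moreover have "continuous_map (state_space B) euclidean (\<lambda>\<phi>. \<phi> f)"
    unfolding state_space_def
    by (rule continuous_map_from_subtopology, rule continuous_map_product_projection, rule assms)
  ultimately show ?thesis
    by (auto dest: continuous_map_compose simp: o_def)
qed

text \<open>Universal property of an initial topology: \<open>QS_topology\<close> is built from
  products and subspaces, so continuity is tested on the evaluations.\<close>

lemma continuous_map_into_QS_topology:
  fixes g :: "'x \<Rightarrow> 'a::unital_cstar_algebra set \<Rightarrow> 'a \<Rightarrow> complex"
  assumes g: "g \<in> topspace X \<rightarrow> QS"
    and cont: "\<And>B f. B \<in> comm_subalgebras \<Longrightarrow> f \<in> B \<Longrightarrow> continuous_map X euclidean (\<lambda>x. g x B f)"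
  shows "continuous_map X QS_topology g"
  unfolding QS_topology_def
proof (intro continuous_map_into_subtopology g)
  show "continuous_map X (product_topology state_space comm_subalgebras) g"
    unfolding continuous_map_componentwise
  proof (intro conjI ballI)
    show "g ` topspace X \<subseteq> extensional comm_subalgebras"
      using g by (auto simp: QS_def PiE_def)
    fix B :: "'a set" assume B: "B \<in> comm_subalgebras"
    have st: "g x B \<in> states B" if "x \<in> topspace X" for x
      using QS_statesD[OF funcset_mem[OF g that] B] .
    show "continuous_map X (state_space B) (\<lambda>x. g x B)"
      unfolding state_space_def
    proof (intro continuous_map_into_subtopology)
      show "continuous_map X (product_topology (\<lambda>_. euclidean) B) (\<lambda>x. g x B)"
        unfolding continuous_map_componentwise
        using cont[OF B] st statesD(1) by blast
    qed (use st in auto)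
  qed
qed

text \<open>Any competing topology makes \<open>restrictions\<close> continuous into
  \<open>QS_topology\<close>, so it contains the preimages that constitute the pullback
  topology.\<close>

lemma coarsest_topology_on_pullback:
  "coarsest_topology_on quasi_states
     (\<lambda>T'. \<forall>B\<in>comm_subalgebras. \<forall>f\<in>B.
        continuous_map T' euclidean (\<lambda>\<mu>. restrictions \<mu> B f))
     (pullback_topology quasi_states restrictions QS_topology)"
  unfolding coarsest_topology_on_def
proof (intro conjI allI impI ballI)
  show "topspace (pullback_topology quasi_states restrictions QS_topology) = quasi_states"
    by (rule topspace_pullback_restrictions)
next
  fix B :: "'a set" and f assume "B \<in> comm_subalgebras" "f \<in> B"
  then show "continuous_map (pullback_topology quasi_states restrictions QS_topology) euclidean
      (\<lambda>\<mu>. restrictions \<mu> B f)"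
    using continuous_map_pullback[OF continuous_map_QS_topology_eval]
    by (auto simp: o_def simp del: restrictions_apply)
next
  fix T' :: "('a \<Rightarrow> complex) topology" and U :: "('a \<Rightarrow> complex) set"
  assume T': "topspace T' = quasi_states \<and> (\<forall>B\<in>comm_subalgebras. \<forall>f\<in>B.
      continuous_map T' euclidean (\<lambda>\<mu>. restrictions \<mu> B f))"
    and U: "openin (pullback_topology quasi_states restrictions QS_topology) U"
  have "continuous_map T' QS_topology restrictions"
    using T' restrictions_in_QS by (intro continuous_map_into_QS_topology) auto
  moreover obtain V where "openin QS_topology V" "U = restrictions -` V \<inter> quasi_states"
    using U by (auto simp: openin_pullback_topology)
  ultimately show "openin T' U"
    using T' by (auto simp: continuous_map_alt)
qed

text \<open>Open sets of the pullback are preimages of open sets, and surjectivity of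
  \<open>f\<close> maps each preimage back onto the original set.\<close>

lemma homeomorphic_map_pullback_topology:
  assumes "bij_betw f A (topspace T)"
  shows "homeomorphic_map (pullback_topology A f T) T f"
proof -
  have top: "topspace (pullback_topology A f T) = A"
    using assms by (auto simp: topspace_pullback_topology bij_betw_def)
  show ?thesis
  proof (rule bijective_open_imp_homeomorphic_map)
    show "continuous_map (pullback_topology A f T) T f"
      using continuous_map_pullback[OF continuous_map_id, of A f T] by (simp add: o_def)
    show "open_map (pullback_topology A f T) T f"
      unfolding open_map_def openin_pullback_topology
    proof safe
      fix U assume U: "openin T U"
      have "f ` (f -` U \<inter> A) = U \<inter> f ` A" by auto
      also have "\<dots> = U"
        using openin_subset[OF U] assms by (auto simp: bij_betw_def)
      finally have "f ` (f -` U \<inter> A) = U" .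
      with U show "openin T (f ` (f -` U \<inter> A))" by simp
    qed
  qed (use assms in \<open>auto simp: top bij_betw_def\<close>)
qed

theorem proposition3p5:
  defines "Q \<equiv> quasi_states :: ('a::unital_cstar_algebra \<Rightarrow> complex) set"
  defines "T \<equiv> pullback_topology Q restrictions QS_topology"
  shows
    "bij_betw restrictions Q QS
     \<and> (\<forall>t\<in>{0..1}.
          (\<forall>m\<in>QS. \<forall>n\<in>QS. QS_combination t m n \<in> (QS :: ('a set \<Rightarrow> 'a \<Rightarrow> complex) set))
        \<and> (\<forall>\<mu>\<in>Q. \<forall>\<nu>\<in>Q.
             (\<lambda>a. (1 - t) *\<^sub>R \<mu> a + t *\<^sub>R \<nu> a) \<in> Q
           \<and> restrictions (\<lambda>a. (1 - t) *\<^sub>R \<mu> a + t *\<^sub>R \<nu> a)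
               = QS_combination t (restrictions \<mu>) (restrictions \<nu>)))
     \<and> homeomorphic_map T QS_topology restrictions
     \<and> coarsest_topology_on Q
         (\<lambda>T'. \<forall>B\<in>comm_subalgebras. \<forall>f\<in>B.
            continuous_map T' euclidean (\<lambda>\<mu>. restrictions \<mu> B f)) T"
  unfolding Q_def T_def
  by (intro conjI ballI bij_betw_restrictions QS_combination_in_QS quasi_states_combination
      restrictions_combination homeomorphic_map_pullback_topology coarsest_topology_on_pullback)
     (auto simp: topspace_QS_topology bij_betw_restrictions)

end
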